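(* Let $n,m\ge 1$, let $1\le s_1<s_2<\cdots<s_m\le n+m$, and let $\boldsymbol{u}=(u_1,\dots,u_n)$ be the strictly increasing list of the elements of $[n+m]\setminus\{s_1,\dots,s_m\}$ (so the spots $s_1,\dots,s_m$ are unavailable). Let $\delta_1=s_1-1$, $\delta_p=s_p-s_{p-1}-1$ for $2\le p\le m$, and $\delta_{m+1}=n+m-s_m$, and let $\delta=(\delta_1,\dots,\delta_{m+1})$. For $0\le k\le n$, the number of distinct outcomes of $\boldsymbol{u}$-parking functions with exactly $k$ lucky cars is $$\left|\bigcup_{|I|=k}\mathcal{O}_{\boldsymbol{u}}(I)\right|=\binom{n}{\delta}\sum_{\substack{(i_1,\dots,i_{m+1})\ \text{nonnegative integers},\\ \sum_p i_p\le \max\{k-\delta_1,\,k-1\}}}\ \prod_{j=1}^{m+1}\left\langle{\delta_j\atop i_j}\right\rangle .$$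
   Context: Notation: $[N]=\{1,\dots,N\}$, $\mathbb{N}=\{1,2,\dots\}$. $\binom{n}{\delta}=\frac{n!}{\delta_1!\,\delta_2!\cdots\delta_{m+1}!}$. $\left\langle{N\atop i}\right\rangle$ is the Eulerian number, the number of permutations of $[N]$ with exactly $i$ descents, with $\left\langle{N\atop 0}\right\rangle=1$ for all $N\ge 0$ and $\left\langle{0\atop i}\right\rangle=0$ for $i>0$. For a weakly increasing vector $\boldsymbol{u}=(u_1,\dots,u_n)$ of positive integers, spot $i\in\mathbb{N}$ on a one-way street has capacity $m_i(\boldsymbol{u})$, the number of times $i$ occurs in $\boldsymbol{u}$ (here 0 or 1). Cars $1,\dots,n$ enter in this order with preferences $\boldsymbol{a}=(a_1,\dots,a_n)\in\mathbb{N}^n$; car $c$ parks in the first spot $j\ge a_c$ in which fewer than $m_j(\boldsymbol{u})$ cars are already parked, and fails to park if there is none. $\boldsymbol{a}$ is a $\boldsymbol{u}$-parking function if all cars park; $\mathrm{PF}(\boldsymbol{u})$ is the set of these. The outcome of $\boldsymbol{a}\in\mathrm{PF}(\boldsymbol{u})$ is $\mathcal{O}_{\boldsymbol{u}}(\boldsymbol{a})=B_1B_2\cdots B_M$ with $M=\max(\boldsymbol{u})$, where $B_i$ is the set of cars parked in spot $i$ if $m_i(\boldsymbol{u})>0$, and $B_i=\mathtt{X}$ if $m_i(\boldsymbol{u})=0$. A car is lucky if it parks in its preferred spot; $\mathsf{Lucky}_{\boldsymbol{u}}(\boldsymbol{a})$ is the set of lucky cars. For $I\subseteq[n]$, $\mathcal{O}_{\boldsymbol{u}}(I)=\{\mathcal{O}_{\boldsymbol{u}}(\boldsymbol{a}):\boldsymbol{a}\in\mathrm{PF}(\boldsymbol{u}),\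 \mathsf{Lucky}_{\boldsymbol{u}}(\boldsymbol{a})=I\}$; the union is over all $I\subseteq[n]$ with $|I|=k$. *)

theory Defs
  imports Complex_Main "HOL-Library.FuncSet" "HOL-Combinatorics.Permutations"
begin

text \<open>
  Cars and spots are numbered from 1. A preference vector \<open>a\<close> is a list, so car \<open>c\<close> prefers
  spot \<open>a ! (c - 1)\<close>. Spot \<open>j\<close> has capacity \<open>count_list u j\<close>.
\<close>

text \<open>
  In the next two definitions, \<open>qs\<close> lists, in order of arrival, where the earlier cars went;
  \<open>None\<close> stands for a car that failed to park.
\<close>

definition has_room :: "nat list \<Rightarrow> nat option list \<Rightarrow> nat \<Rightarrow> bool" where
  "has_room u qs j \<longleftrightarrow> count_list qs (Some j) < count_list u j"

definition park_car :: "nat list \<Rightarrow> nat option list \<Rightarrow> nat \<Rightarrow> nat option" where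
  "park_car u qs x =
     (if \<exists>j\<ge>x. has_room u qs j then Some (LEAST j. x \<le> j \<and> has_room u qs j) else None)"

primrec park_from :: "nat list \<Rightarrow> nat option list \<Rightarrow> nat list \<Rightarrow> nat option list" where
  "park_from u qs [] = qs"
| "park_from u qs (x # xs) = park_from u (qs @ [park_car u qs x]) xs"

definition parked_spot :: "nat list \<Rightarrow> nat list \<Rightarrow> nat \<Rightarrow> nat option" where
  "parked_spot u a c = park_from u [] a ! (c - 1)"

definition PF :: "nat list \<Rightarrow> nat list set" where
  "PF u = {a. length a = length u \<and> (\<forall>x\<in>set a. 1 \<le> x) \<and>
              (\<forall>c\<in>{1..length u}. parked_spot u a c \<noteq> None)}"

datatype spot_content = Cars "nat set" | Unavailable

definition outcome :: "nat list \<Rightarrow> nat list \<Rightarrow> spot_content list" where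
  "outcome u a =
     map (\<lambda>i. if count_list u i > 0
              then Cars {c \<in> {1..length u}. parked_spot u a c = Some i}
              else Unavailable)
         [1..<Suc (Max (set u))]"

definition Lucky :: "nat list \<Rightarrow> nat list \<Rightarrow> nat set" where
  "Lucky u a = {c \<in> {1..length u}. parked_spot u a c = Some (a ! (c - 1))}"

definition outcomes_with_lucky :: "nat list \<Rightarrow> nat set \<Rightarrow> spot_content list set" where
  "outcomes_with_lucky u I = {outcome u a | a. a \<in> PF u \<and> Lucky u a = I}"

definition descents :: "nat \<Rightarrow> (nat \<Rightarrow> nat) \<Rightarrow> nat set" where
  "descents N p = {j \<in> {1..<N}. p j > p (Suc j)}"

definition eulerian :: "nat \<Rightarrow> nat \<Rightarrow> nat" where
  "eulerian N i = card {p. p permutes {1..N} \<and> card (descents N p) = i}"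

end

theory Submission
  imports Defs
begin

text \<open>
  An outcome places the \<open>n\<close> cars bijectively on the \<open>n\<close> available spots, so it is a map \<open>g\<close> from
  spots to cars (a filling). A car in spot \<open>x\<close> may have preferred \<open>x\<close> itself, and is then lucky. It
  can be made unlucky exactly when spot \<open>x - 1\<close> exists and cannot take it on arrival, that is,
  when \<open>x - 1\<close> is unavailable or already holds an earlier car: preferring \<open>x - 1\<close> then works, and no
  unlucky preference can avoid passing \<open>x - 1\<close>. Hence the cars forced to be lucky are the one in
  spot 1 (if available) and every car whose left neighbour on an adjacent available spot is a later
  car (\<open>forced_lucky\<close>). These choices are independent, so \<open>g\<close> is the outcome of
  a parking function with exactly \<open>k\<close> lucky cars iff at most \<open>k\<close> cars are forced
  (\<open>outcomes_with_lucky_card\<close>).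

  The unavailable spots cut the street into \<open>m + 1\<close> blocks of consecutive available spots, the
  \<open>j\<close>-th of length \<open>\<delta> j\<close>. Reading \<open>g\<close> block by block turns it into a sequence of words
  that together use every car once (\<open>fillings_block_words\<close>), and the forced cars outside spot 1
  are precisely the descents inside these words (\<open>card_gap_descents\<close>). Spot 1 is available iff
  \<open>\<delta> 1 > 0\<close>, so at most \<open>k\<close> cars are forced iff there are at most \<open>k\<close> descents
  when \<open>\<delta> 1 = 0\<close>, and at most \<open>k - 1\<close> when \<open>\<delta> 1 > 0\<close>. Both cases
  are the bound \<open>max (k - \<delta> 1) (k - 1)\<close>.

  It remains to count sequences of words with prescribed lengths \<open>\<delta> j\<close> and descent numbers
  \<open>i j\<close>. The set of cars of each block can be chosen in a multinomial number of ways, and a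
  set of \<open>\<delta> j\<close> cars has an Eulerian number of arrangements with \<open>i j\<close> descents
  (\<open>card_block_words_descents\<close>). Summing over the admissible \<open>i\<close> gives the formula.
\<close>

section \<open>Parking on distinct spots\<close>

lemma park_from_snoc:
  "park_from u qs (xs @ [x]) = park_from u qs xs @ [park_car u (park_from u qs xs) x]"
  by (induction xs arbitrary: qs) auto

lemma length_park_from [simp]: "length (park_from u qs xs) = length qs + length xs"
  by (induction xs arbitrary: qs) auto

lemma park_car_eq_Some_iff:
  "park_car u qs x = Some y \<longleftrightarrow>
     x \<le> y \<and> has_room u qs y \<and> (\<forall>j. x \<le> j \<and> j < y \<longrightarrow> \<not> has_room u qs j)"
proof -
  have "(LEAST j. x \<le> j \<and> has_room u qs j) = y \<longleftrightarrow>
     x \<le> y \<and> has_room u qs y \<and> (\<forall>j. x \<le> j \<and> j < y \<longrightarrow> \<not> has_room u qs j)"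
    if "\<exists>j\<ge>x. has_room u qs j"
  proof -
    let ?P = "\<lambda>j. x \<le> j \<and> has_room u qs j"
    have "?P (Least ?P)"
      using that by (rule LeastI_ex)
    moreover have "\<not> ?P j" if "j < Least ?P" for j
      using that by (rule not_less_Least)
    moreover have "Least ?P = y" if "?P y" "\<forall>j. x \<le> j \<and> j < y \<longrightarrow> \<not> has_room u qs j"
      using that by (intro Least_equality conjI leI notI) auto
    ultimately show ?thesis
      by blast
  qed
  then show ?thesis
    unfolding park_car_def by (cases "\<exists>j\<ge>x. has_room u qs j") (simp, auto)
qed

text \<open>
  The condition under which car \<open>c\<close> with preference \<open>x\<close> ends up in \<open>spot c\<close> if
  every earlier car \<open>c'\<close> is in \<open>spot c'\<close>, for spots of capacity one.
\<close>
definition parks_at :: "nat list \<Rightarrow> (nat \<Rightarrow> nat) \<Rightarrow> nat \<Rightarrow> nat \<Rightarrow> bool" where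
  "parks_at u spot x c \<longleftrightarrow> x \<le> spot c \<and> spot c \<in> set u \<and> spot c \<notin> spot ` {1..<c} \<and>
     (\<forall>j\<in>set u. x \<le> j \<and> j < spot c \<longrightarrow> j \<in> spot ` {1..<c})"

lemma has_room_distinct:
  assumes "distinct u"
  shows "has_room u (map (Some \<circ> spot) [1..<c]) j \<longleftrightarrow> j \<in> set u \<and> j \<notin> spot ` {1..<c}"
proof -
  have "count_list u j = (if j \<in> set u then 1 else 0)"
    using assms by (induction u) auto
  moreover have "count_list (map (Some \<circ> spot) [1..<c]) (Some j) = 0 \<longleftrightarrow> j \<notin> spot ` {1..<c}"
    by (auto simp: count_list_0_iff)
  ultimately show ?thesis
    unfolding has_room_def by auto
qed

text \<open>
  Since each car's spot is determined by the earlier ones, a guess \<open>spot\<close> for all final positions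
  can be verified car by car, without following the process itself.
\<close>
lemma park_from_eq_iff:
  assumes "distinct u"
  shows "park_from u [] a = map (Some \<circ> spot) [1..<Suc (length a)] \<longleftrightarrow>
     (\<forall>c\<in>{1..length a}. parks_at u spot (a ! (c - 1)) c)"
proof (induction a rule: rev_induct)
  case Nil
  then show ?case by simp
next
  case (snoc x a)
  let ?c = "Suc (length a)"
  have "park_from u [] (a @ [x]) = map (Some \<circ> spot) [1..<Suc ?c] \<longleftrightarrow>
      park_from u [] a = map (Some \<circ> spot) [1..<?c] \<and>
      park_car u (map (Some \<circ> spot) [1..<?c]) x = Some (spot ?c)"
    by (auto simp: park_from_snoc)
  also have "park_car u (map (Some \<circ> spot) [1..<?c]) x = Some (spot ?c) \<longleftrightarrow> parks_at u spot x ?c"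
    unfolding park_car_eq_Some_iff has_room_distinct[OF assms] parks_at_def by blast
  also have "park_from u [] a = map (Some \<circ> spot) [1..<?c] \<longleftrightarrow>
      (\<forall>c\<in>{1..length a}. parks_at u spot ((a @ [x]) ! (c - 1)) c)"
    unfolding snoc.IH by (intro ball_cong refl) (auto simp: nth_append)
  also have "\<dots> \<and> parks_at u spot x ?c \<longleftrightarrow>
      (\<forall>c\<in>{1..length (a @ [x])}. parks_at u spot ((a @ [x]) ! (c - 1)) c)"
    by (simp add: atLeastAtMostSuc_conv conj_commute)
  finally show ?case
    by simp
qed

lemma parked_spot_eq_iff:
  assumes "distinct u"
  shows "(\<forall>c\<in>{1..length a}. parked_spot u a c = Some (spot c)) \<longleftrightarrow>
     (\<forall>c\<in>{1..length a}. parks_at u spot (a ! (c - 1)) c)"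
proof -
  have "(\<forall>c\<in>{1..length a}. parked_spot u a c = Some (spot c)) \<longleftrightarrow>
      park_from u [] a = map (Some \<circ> spot) [1..<Suc (length a)]" (is "?L \<longleftrightarrow> ?R")
  proof
    assume L: ?L
    show ?R
    proof (rule nth_equalityI)
      fix i assume "i < length (park_from u [] a)"
      then show "park_from u [] a ! i = map (Some \<circ> spot) [1..<Suc (length a)] ! i"
        using L[rule_format, of "Suc i"] by (simp add: parked_spot_def del: upt_Suc)
    qed (simp del: upt_Suc)
  next
    assume ?R
    then show ?L
      by (auto simp: parked_spot_def simp del: upt_Suc)
  qed
  then show ?thesis
    using park_from_eq_iff[OF assms] by simp
qed

section \<open>Outcomes with a given number of lucky cars\<close>

definition filled_street :: "nat list \<Rightarrow> (nat \<Rightarrow> nat) \<Rightarrow> spot_content list" where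
  "filled_street u g = map (\<lambda>x. if x \<in> set u then Cars {g x} else Unavailable) [1..<Suc (Max (set u))]"

text \<open>
  Fillings are taken extensional so that distinct ones differ on an available spot and can be
  counted.
\<close>
definition fillings :: "nat list \<Rightarrow> (nat \<Rightarrow> nat) set" where
  "fillings u = {g \<in> extensional (set u). bij_betw g (set u) {1..length u}}"

text \<open>
  The spots whose car must be lucky: parking there with a smaller preference would require passing
  the free spot on its left, or starting before spot 1.
\<close>
definition forced_lucky :: "nat list \<Rightarrow> (nat \<Rightarrow> nat) \<Rightarrow> nat set" where
  "forced_lucky u g = {x \<in> set u. x = 1 \<or> (x - 1 \<in> set u \<and> g x < g (x - 1))}"

lemma inj_on_filled_street:
  assumes "0 \<notin> set u"
  shows "inj_on (filled_street u) (fillings u)"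
proof (rule inj_onI)
  fix g h assume g: "g \<in> fillings u" and h: "h \<in> fillings u" and eq: "filled_street u g = filled_street u h"
  have "g x = h x" if "x \<in> set u" for x
  proof -
    have "x \<in> set [1..<Suc (Max (set u))]"
      using that assms by (auto simp del: upt_Suc simp: less_Suc_eq_le Suc_le_eq intro: gr0I)
    then show ?thesis
      using eq that unfolding filled_street_def map_eq_conv by fastforce
  qed
  then show "g = h"
    using g h unfolding fillings_def by (auto intro: extensionalityI)
qed

lemma outcome_eq_filled_street:
  assumes "bij_betw g (set u) {1..length u}"
    and "\<And>c. c \<in> {1..length u} \<Longrightarrow> parked_spot u a c = Some (inv_into (set u) g c)"
  shows "outcome u a = filled_street u g"
proof -
  have "{c \<in> {1..length u}. parked_spot u a c = Some x} = {g x}" if "x \<in> set u" for x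
    using assms that bij_betw_inv_into_left[OF assms(1)] bij_betw_inv_into_right[OF assms(1)]
      bij_betwE[OF assms(1)] by force
  then show ?thesis
    unfolding outcome_def filled_street_def
    using count_list_0_iff by (auto simp: count_list_0_iff simp flip: neq0_conv)
qed

text \<open>
  An unlucky car in spot \<open>x\<close> starts at some spot between 1 and \<open>x - 1\<close> and so finds \<open>x - 1\<close>
  either unavailable or occupied by an earlier car. Therefore \<open>x\<close> is not a forced spot.
\<close>
lemma parking_function_filling:
  assumes "distinct u" and a: "a \<in> PF u"
  obtains g where "g \<in> fillings u" and "outcome u a = filled_street u g"
    and "g ` forced_lucky u g \<subseteq> Lucky u a"
proof -
  define N where "N = length u"
  define spot where "spot c = the (parked_spot u a c)" for c
  have len: "length a = N" and pos: "\<forall>x\<in>set a. 1 \<le> x"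
    and some: "\<And>c. c \<in> {1..N} \<Longrightarrow> parked_spot u a c = Some (spot c)"
    using a by (auto simp: PF_def spot_def N_def)
  have parks: "parks_at u spot (a ! (c - 1)) c" if "c \<in> {1..N}" for c
    using parked_spot_eq_iff[OF assms(1), of a spot] some that len by simp
  have inj: "inj_on spot {1..N}"
  proof (rule linorder_inj_onI)
    fix c d assume cd: "c < d" "c \<in> {1..N}" "d \<in> {1..N}"
    then have "spot c \<in> spot ` {1..<d}"
      by auto
    then show "spot c \<noteq> spot d"
      using parks[OF cd(3)] unfolding parks_at_def by metis
  qed auto
  have bij: "bij_betw spot {1..N} (set u)"
    unfolding bij_betw_def
  proof (intro conjI inj card_subset_eq)
    show "spot ` {1..N} \<subseteq> set u"
      using parks by (auto simp: parks_at_def)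
    show "card (spot ` {1..N}) = card (set u)"
      using card_image[OF inj] distinct_card[OF assms(1)] by (simp add: N_def)
  qed simp
  define g where "g = restrict (inv_into {1..N} spot) (set u)"
  have gbij: "bij_betw g (set u) {1..N}"
    using bij_betw_inv_into[OF bij] unfolding g_def
    by (rule bij_betw_cong[THEN iffD1, rotated]) simp
  then have g: "g \<in> fillings u"
    by (simp add: fillings_def N_def g_def)
  have g_spot: "g (spot c) = c" if "c \<in> {1..N}" for c
    using bij_betw_inv_into_left[OF bij that] bij_betwE[OF bij] that by (simp add: g_def)
  have spot_g: "spot (g x) = x" "g x \<in> {1..N}" if "x \<in> set u" for x
    using bij_betw_inv_into_right[OF bij that] bij_betwE[OF gbij] that by (simp_all add: g_def)
  have "inv_into (set u) g c = spot c" if "c \<in> {1..N}" for c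
    using bij_betw_imp_inj_on[OF gbij] bij_betwE[OF bij] that g_spot[OF that]
    by (intro inv_into_f_eq) auto
  then have out: "outcome u a = filled_street u g"
    using gbij some by (intro outcome_eq_filled_street) (auto simp: N_def)
  have "g x \<in> Lucky u a" if x: "x \<in> forced_lucky u g" for x
  proof (rule ccontr)
    assume unlucky: "g x \<notin> Lucky u a"
    have xu: "x \<in> set u" and why: "x = 1 \<or> (x - 1 \<in> set u \<and> g x < g (x - 1))"
      using x by (auto simp: forced_lucky_def)
    let ?y = "a ! (g x - 1)"
    have "?y \<in> set a"
      using spot_g(2)[OF xu] len by auto
    then have "1 \<le> ?y"
      using pos by simp
    moreover have "?y < x"
      using unlucky parks[of "g x"] spot_g[OF xu] some[of "g x"]
      by (auto simp: Lucky_def parks_at_def N_def)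
    ultimately have "x - 1 \<in> set u" "g x < g (x - 1)" "?y \<le> x - 1" "x - 1 < x"
      using why by auto
    then obtain c where "c \<in> {1..<g x}" "x - 1 = spot c"
      using parks[of "g x"] spot_g[OF xu] by (auto simp: parks_at_def)
    then show False
      using g_spot[of c] \<open>g x < g (x - 1)\<close> spot_g(2)[OF xu] by auto
  qed
  then show ?thesis
    using that[OF g out] by blast
qed

text \<open>
  Conversely, the lucky set can be prescribed freely above the forced cars: let each car of \<open>I\<close>
  prefer its own spot, and every other car the spot just to the left of its own. The latter is a
  legal preference that leads to the right spot because the car is not forced.
\<close>
lemma filling_parking_function:
  assumes "distinct u" and "0 \<notin> set u" and g: "g \<in> fillings u"
    and I: "I \<subseteq> {1..length u}" and forced: "g ` forced_lucky u g \<subseteq> I"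
  obtains a where "a \<in> PF u" and "outcome u a = filled_street u g" and "Lucky u a = I"
proof -
  define N where "N = length u"
  define spot where "spot = inv_into (set u) g"
  have gbij: "bij_betw g (set u) {1..N}"
    using g by (simp add: fillings_def N_def)
  have bij: "bij_betw spot {1..N} (set u)"
    unfolding spot_def by (rule bij_betw_inv_into[OF gbij])
  have g_spot: "g (spot c) = c" "spot c \<in> set u" "spot c > 0" if "c \<in> {1..N}" for c
  proof -
    show "g (spot c) = c"
      using bij_betw_inv_into_right[OF gbij that] by (simp add: spot_def)
    show "spot c \<in> set u"
      using bij_betwE[OF bij] that by blast
    then show "spot c > 0"
      using assms(2) by (metis gr0I)
  qed
  have spot_g: "spot (g x) = x" "g x \<in> {1..N}" if "x \<in> set u" for x
    using bij_betw_inv_into_left[OF gbij that] bij_betwE[OF gbij] that by (simp_all add: spot_def)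
  define pref where "pref c = (if c \<in> I then spot c else spot c - 1)" for c
  define a where "a = map pref [1..<Suc N]"
  have len: "length a = N"
    by (simp add: a_def)
  have nth: "a ! (c - 1) = pref c" if "c \<in> {1..N}" for c
    using that by (auto simp: a_def simp del: upt_Suc)
  have free: "spot c \<noteq> 1" "spot c - 1 \<in> set u \<Longrightarrow> g (spot c - 1) < c"
    if "c \<in> {1..N}" "c \<notin> I" for c
  proof -
    have "spot c \<notin> forced_lucky u g"
      using that forced g_spot(1)[OF that(1)] by (metis image_subset_iff)
    moreover have "g (spot c - 1) \<noteq> c" if "spot c - 1 \<in> set u"
      using spot_g(1)[OF that] g_spot(3)[OF \<open>c \<in> {1..N}\<close>] by auto
    ultimately show "spot c \<noteq> 1" "spot c - 1 \<in> set u \<Longrightarrow> g (spot c - 1) < c"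
      using g_spot(1,2)[OF that(1)] by (auto simp: forced_lucky_def)
  qed
  have parks: "parks_at u spot (a ! (c - 1)) c" if c: "c \<in> {1..N}" for c
    unfolding parks_at_def nth[OF c]
  proof (intro conjI ballI impI)
    show "pref c \<le> spot c"
      by (simp add: pref_def)
    show "spot c \<in> set u"
      using g_spot c by simp
    show "spot c \<notin> spot ` {1..<c}"
      using bij_betw_imp_inj_on[OF bij] c by (auto dest!: inj_onD)
    fix j assume j: "j \<in> set u" "pref c \<le> j \<and> j < spot c"
    then have "c \<notin> I" "j = spot c - 1"
      by (auto simp: pref_def split: if_splits)
    then have "g j \<in> {1..<c}"
      using free(2)[OF c] spot_g(2)[of j] j by auto
    then show "j \<in> spot ` {1..<c}"
      using spot_g(1)[OF j(1)] by (metis imageI)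
  qed
  then have spots: "parked_spot u a c = Some (spot c)" if "c \<in> {1..N}" for c
    using parked_spot_eq_iff[OF assms(1), of a spot] that by (simp add: len)
  have "a \<in> PF u"
    unfolding PF_def
  proof (intro CollectI conjI ballI)
    fix x assume "x \<in> set a"
    then obtain c where c: "c \<in> {1..N}" and x: "x = pref c"
      by (force simp: a_def simp del: upt_Suc)
    then show "1 \<le> x"
      using free(1)[OF c] g_spot(3)[OF c] by (auto simp: pref_def)
  qed (use spots len in \<open>auto simp: N_def\<close>)
  moreover have "outcome u a = filled_street u g"
    using gbij spots by (intro outcome_eq_filled_street) (auto simp: N_def spot_def)
  moreover have "Lucky u a = I"
  proof -
    have "parked_spot u a c = Some (a ! (c - 1)) \<longleftrightarrow> c \<in> I" if c: "c \<in> {1..N}" for c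
      unfolding spots[OF c] nth[OF c] using g_spot(3)[OF c] by (auto simp: pref_def)
    then show ?thesis
      using I by (auto simp: Lucky_def N_def)
  qed
  ultimately show ?thesis
    by (rule that)
qed

lemma outcomes_with_lucky_card:
  assumes "distinct u" and "0 \<notin> set u" and "k \<le> length u"
  shows "(\<Union>I\<in>{I. I \<subseteq> {1..length u} \<and> card I = k}. outcomes_with_lucky u I) =
    filled_street u ` {g \<in> fillings u. card (forced_lucky u g) \<le> k}" (is "?L = ?R")
proof (intro equalityI subsetI)
  have card_forced: "card (g ` forced_lucky u g) = card (forced_lucky u g)"
    if "g \<in> fillings u" for g
  proof (rule card_image, rule inj_on_subset)
    show "inj_on g (set u)"
      using that by (simp add: fillings_def bij_betw_def)
  qed (auto simp: forced_lucky_def)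
  {
    fix X assume "X \<in> ?L"
    then obtain a where a: "a \<in> PF u" "X = outcome u a" "card (Lucky u a) = k"
      unfolding outcomes_with_lucky_def by blast
    obtain g where g: "g \<in> fillings u" "outcome u a = filled_street u g"
      "g ` forced_lucky u g \<subseteq> Lucky u a"
      using parking_function_filling[OF assms(1) a(1)] .
    have "card (g ` forced_lucky u g) \<le> k"
      unfolding a(3)[symmetric] using g(3) by (intro card_mono) (auto simp: Lucky_def)
    then show "X \<in> ?R"
      unfolding a(2) g(2) using g(1) card_forced[OF g(1)] by (intro imageI CollectI conjI) simp_all
  next
    fix X assume "X \<in> ?R"
    then obtain g where g: "g \<in> fillings u" "card (forced_lucky u g) \<le> k" and X: "X = filled_street u g"
      by blast
    have sub: "g ` forced_lucky u g \<subseteq> {1..length u}"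
      using g(1) by (auto simp: fillings_def forced_lucky_def bij_betw_def)
    have le: "card (g ` forced_lucky u g) \<le> k" "k \<le> card {1..length u}"
      using g(2) card_forced[OF g(1)] assms(3) by simp_all
    obtain I where I: "g ` forced_lucky u g \<subseteq> I" "I \<subseteq> {1..length u}" "card I = k"
      using exists_subset_between[OF le sub] by auto
    obtain a where "a \<in> PF u" "outcome u a = filled_street u g" "Lucky u a = I"
      using filling_parking_function[OF assms(1,2) g(1) I(2,1)] .
    then show "X \<in> ?L"
      using I(2,3) unfolding X outcomes_with_lucky_def
      by (intro UN_I[of I]) (auto intro!: exI[of _ a])
  }
qed

section \<open>Words cut into blocks, counted by descents\<close>

definition list_descents :: "nat list \<Rightarrow> nat" where
  "list_descents w = card {j. Suc j < length w \<and> w ! Suc j < w ! j}"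

text \<open>
  Descents depend only on the relative order of the letters, so the increasing enumeration of \<open>A\<close>
  carries permutations of \<open>{1..card A}\<close> to arrangements of \<open>A\<close> with the same number of descents.
\<close>
lemma card_words_eulerian:
  assumes "finite A"
  shows "card {w. distinct w \<and> set w = A \<and> list_descents w = i} = eulerian (card A) i"
proof -
  define N where "N = card A"
  define f where "f t = sorted_list_of_set A ! (t - 1)" for t
  have mono: "f s < f t \<longleftrightarrow> s < t" if "s \<in> {1..N}" "t \<in> {1..N}" for s t
  proof -
    have "f s < f t" if "s < t" "s \<in> {1..N}" "t \<in> {1..N}" for s t
      unfolding f_def using that
      by (intro sorted_wrt_nth_less[OF strict_sorted_list_of_set]) (auto simp: N_def)
    from this[of s t] this[of t s] show ?thesis
      using that by (cases s t rule: linorder_cases) auto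
  qed
  have f_inj: "inj_on f {1..N}"
  proof (rule linorder_inj_onI)
    fix s t assume "s < t" "s \<in> {1..N}" "t \<in> {1..N}"
    then show "f s \<noteq> f t"
      using mono[of s t] by simp
  qed auto
  have f_img: "f ` {1..N} \<subseteq> A"
    using assms nth_mem[of _ "sorted_list_of_set A"] by (force simp: f_def N_def)
  have f_bij: "bij_betw f {1..N} A"
    unfolding bij_betw_def using assms f_img f_inj
    by (intro conjI card_subset_eq) (auto simp: card_image N_def)
  define word where "word p = map (f \<circ> p) [1..<Suc N]" for p
  have nth: "word p ! j = f (p (Suc j))" if "j < N" for p j
    using that by (simp add: word_def del: upt_Suc)
  have des: "list_descents (word p) = card (descents N p)" if p: "p permutes {1..N}" for p
  proof -
    have len: "length (word p) = N"
      by (simp add: word_def)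
    have inN: "p t \<in> {1..N}" if "1 \<le> t" "t \<le> N" for t
      using permutes_in_image[OF p, of t] that by simp
    have "bij_betw Suc {j. Suc j < length (word p) \<and> word p ! Suc j < word p ! j} (descents N p)"
    proof (rule bij_betwI[where g = "\<lambda>j. j - 1"])
      show "Suc \<in> {j. Suc j < length (word p) \<and> word p ! Suc j < word p ! j} \<rightarrow> descents N p"
        unfolding len by (auto simp: descents_def nth mono[OF inN inN])
      show "(\<lambda>j. j - 1) \<in> descents N p \<rightarrow> {j. Suc j < length (word p) \<and> word p ! Suc j < word p ! j}"
        unfolding len by (auto simp: descents_def nth mono[OF inN inN])
    qed (auto simp: descents_def)
    then show ?thesis
      unfolding list_descents_def by (rule bij_betw_same_card)
  qed
  have "bij_betw word {p. p permutes {1..N} \<and> card (descents N p) = i}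
     {w. distinct w \<and> set w = A \<and> list_descents w = i}"
    unfolding bij_betw_def
  proof (intro conjI equalityI subsetI inj_onI)
    fix p q assume pq: "p \<in> {p. p permutes {1..N} \<and> card (descents N p) = i}"
      "q \<in> {p. p permutes {1..N} \<and> card (descents N p) = i}" "word p = word q"
    have "p t = q t" for t
    proof (cases "t \<in> {1..N}")
      case True
      then have "f (p t) = f (q t)"
        using pq(3) nth[of "t - 1" p] nth[of "t - 1" q] by auto
      then show ?thesis
        using True pq(1,2) permutes_in_image[of p "{1..N}" t] permutes_in_image[of q "{1..N}" t]
        by (auto dest!: inj_onD[OF f_inj])
    next
      case False
      then show ?thesis
        using pq by (auto simp: permutes_def)
    qed
    then show "p = q" ..
  next
    fix w assume "w \<in> word ` {p. p permutes {1..N} \<and> card (descents N p) = i}"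
    then obtain p where p: "p permutes {1..N}" "card (descents N p) = i" and w: "w = word p"
      by auto
    have "bij_betw (f \<circ> p) {1..N} A"
      using permutes_imp_bij[OF p(1)] f_bij by (rule bij_betw_trans)
    then show "w \<in> {w. distinct w \<and> set w = A \<and> list_descents w = i}"
      using des[OF p(1)] p(2) w
      by (auto simp: word_def distinct_map bij_betw_def atLeastLessThanSuc_atLeastAtMost
          simp del: upt_Suc)
  next
    fix w assume w: "w \<in> {w. distinct w \<and> set w = A \<and> list_descents w = i}"
    then have len: "length w = N"
      by (auto simp: N_def distinct_card)
    define p where "p t = (if t \<in> {1..N} then inv_into {1..N} f (w ! (t - 1)) else t)" for t
    have fp: "f (p t) = w ! (t - 1)" "p t \<in> {1..N}" if "t \<in> {1..N}" for t
    proof -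
      have "w ! (t - 1) \<in> f ` {1..N}"
        using that w len f_bij by (auto simp: bij_betw_def)
      from f_inv_into_f[OF this] inv_into_into[OF this]
      show "f (p t) = w ! (t - 1)" "p t \<in> {1..N}"
        using that by (auto simp: p_def)
    qed
    have "inj_on p {1..N}"
    proof (rule inj_onI)
      fix s t assume st: "s \<in> {1..N}" "t \<in> {1..N}" "p s = p t"
      then have "w ! (s - 1) = w ! (t - 1)"
        using fp by metis
      moreover have "s - 1 < length w" "t - 1 < length w"
        using st len by auto
      ultimately have "s - 1 = t - 1"
        using w nth_eq_iff_index_eq[of w "s - 1" "t - 1"] by simp
      then show "s = t"
        using st(1,2) by auto
    qed
    then have "p permutes {1..N}"
      by (rule inj_imp_permutes) (use fp(2) in \<open>auto simp: p_def\<close>)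
    moreover have "word p = w"
      by (rule nth_equalityI) (use len fp in \<open>auto simp: word_def simp del: upt_Suc\<close>)
    ultimately show "w \<in> word ` {p. p permutes {1..N} \<and> card (descents N p) = i}"
      using w des by auto
  qed
  then show ?thesis
    unfolding eulerian_def N_def[symmetric] by (simp only: bij_betw_same_card)
qed

definition block_words :: "'a set \<Rightarrow> nat list \<Rightarrow> 'a list list set" where
  "block_words S ds = {ws. map length ws = ds \<and> distinct (concat ws) \<and> set (concat ws) = S}"

lemma block_words_Cons:
  "w # ws \<in> block_words S (d # ds) \<longleftrightarrow>
     distinct w \<and> set w \<subseteq> S \<and> card (set w) = d \<and> ws \<in> block_words (S - set w) ds"
  unfolding block_words_def by (auto simp: distinct_card)

lemma finite_block_words:
  assumes "finite S"
  shows "finite (block_words S ds)"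
proof (rule finite_subset)
  show "block_words S ds \<subseteq> {ws. set ws \<subseteq> {w. set w \<subseteq> S \<and> length w \<le> sum_list ds} \<and> length ws = length ds}"
    by (auto simp: block_words_def intro!: member_le_sum_list)
  show "finite \<dots>"
    using assms by (intro finite_lists_length_eq finite_lists_length_le)
qed

text \<open>
  Induction on the number of blocks: choose the set \<open>A\<close> of letters of the first word, arrange it, and
  distribute the remaining letters. The factorials of the lengths are moved to the left-hand side
  so that the multinomial coefficient is built up from binomial ones without division.
\<close>
lemma card_block_words_descents:
  assumes "finite S" and "card S = sum_list ds" and "length is = length ds"
  shows "card {ws \<in> block_words S ds. map list_descents ws = is} * prod_list (map fact ds) =
    fact (card S) * prod_list (map2 eulerian ds is)"
  using assms
proof (induction ds arbitrary: S "is")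
  case Nil
  then have "{ws \<in> block_words S []. map list_descents ws = is} = {[]}"
    by (auto simp: block_words_def)
  then show ?case using Nil by simp
next
  case (Cons d ds)
  then obtain i js where is_def: "is = i # js" and len: "length js = length ds"
    by (metis length_Suc_conv)
  define W where "W A = {w. distinct w \<and> set w = A \<and> list_descents w = i}" for A
  define B where "B A = {ws \<in> block_words (S - A) ds. map list_descents ws = js}" for A
  define \<A> where "\<A> = {A. A \<subseteq> S \<and> card A = d}"
  have fin: "finite A" "finite (S - A)" "card (S - A) = sum_list ds" if "A \<in> \<A>" for A
  proof -
    have A: "A \<subseteq> S" "card A = d"
      using that by (auto simp: \<A>_def)
    then show "finite A" "finite (S - A)"
      using Cons.prems(1) finite_subset by auto
    then show "card (S - A) = sum_list ds"
      using A Cons.prems(2) by (simp add: card_Diff_subset)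
  qed
  have "{ws \<in> block_words S (d # ds). map list_descents ws = is} =
      (\<lambda>(A, w, ws). w # ws) ` (SIGMA A:\<A>. W A \<times> B A)" (is "?X = ?f ` ?Y")
  proof (intro equalityI subsetI)
    fix ws assume ws: "ws \<in> ?X"
    then obtain v vs where "ws = v # vs"
      by (cases ws) (auto simp: block_words_def)
    then show "ws \<in> ?f ` ?Y"
      using ws by (intro image_eqI[of _ _ "(set v, v, vs)"])
        (auto simp: block_words_Cons is_def W_def B_def \<A>_def)
  next
    fix ws assume "ws \<in> ?f ` ?Y"
    then show "ws \<in> ?X"
      by (auto simp: block_words_Cons is_def W_def B_def \<A>_def)
  qed
  moreover have "inj_on ?f ?Y"
    by (auto simp: inj_on_def W_def)
  ultimately have "card ?X = card ?Y"
    by (simp add: card_image)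
  also have "\<dots> = (\<Sum>A\<in>\<A>. card (W A) * card (B A))"
  proof -
    have "finite (W A)" if "A \<in> \<A>" for A
      by (rule finite_subset[OF _ finite_subset_distinct[OF fin(1)[OF that]]]) (auto simp: W_def)
    moreover have "finite (B A)" if "A \<in> \<A>" for A
      using finite_block_words[OF fin(2)[OF that]] by (simp add: B_def)
    moreover have "finite \<A>"
      using Cons.prems(1) by (simp add: \<A>_def)
    ultimately show ?thesis
      by (simp add: card_SigmaI card_cartesian_product)
  qed
  finally have "card ?X * prod_list (map fact ds) =
      (\<Sum>A\<in>\<A>. card (W A) * (card (B A) * prod_list (map fact ds)))"
    by (simp add: sum_distrib_right mult.assoc)
  also have "\<dots> = (\<Sum>A\<in>\<A>. eulerian d i * (fact (sum_list ds) * prod_list (map2 eulerian ds js)))"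
  proof (rule sum.cong[OF refl])
    fix A assume A: "A \<in> \<A>"
    have "card (W A) = eulerian d i"
      using card_words_eulerian[OF fin(1)[OF A]] A by (simp add: W_def \<A>_def)
    moreover have "card (B A) * prod_list (map fact ds) =
        fact (sum_list ds) * prod_list (map2 eulerian ds js)"
      unfolding B_def using Cons.IH[OF fin(2,3)[OF A] len] fin(3)[OF A] by simp
    ultimately show "card (W A) * (card (B A) * prod_list (map fact ds)) =
        eulerian d i * (fact (sum_list ds) * prod_list (map2 eulerian ds js))"
      by simp
  qed
  also have "\<dots> = ((d + sum_list ds) choose d) * fact (sum_list ds) *
      prod_list (map2 eulerian (d # ds) is)"
    using Cons.prems n_subsets[of S d] by (simp add: \<A>_def is_def)
  finally have "card ?X * prod_list (map fact (d # ds)) =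
      (fact d * fact (sum_list ds) * ((d + sum_list ds) choose d)) * prod_list (map2 eulerian (d # ds) is)"
    by (simp add: mult_ac)
  also have "fact d * fact (sum_list ds) * ((d + sum_list ds) choose d) = fact (card S)"
    using binomial_fact_lemma[of d "d + sum_list ds"] Cons.prems by simp
  finally show ?case .
qed

text \<open>
  A constraint on the total number of descents splits into the finitely many vectors of
  descent numbers that satisfy it; \<open>K\<close> has to be finite for the sum over these vectors to be finite.
\<close>
lemma card_block_words_total_descents:
  fixes \<delta> :: "nat \<Rightarrow> nat"
  assumes "finite S" and "card S = (\<Sum>p=1..r. \<delta> p)" and "finite K"
  shows "real (card {ws \<in> block_words S (map \<delta> [1..<Suc r]). sum_list (map list_descents ws) \<in> K}) =
    fact (card S) / (\<Prod>p=1..r. fact (\<delta> p)) *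
    real (\<Sum>i\<in>{i \<in> {1..r} \<rightarrow>\<^sub>E (UNIV :: nat set). (\<Sum>p=1..r. i p) \<in> K}. \<Prod>j=1..r. eulerian (\<delta> j) (i j))"
proof -
  let ?L = "[1..<Suc r]"
  define \<I> where "\<I> = {i \<in> {1..r} \<rightarrow>\<^sub>E (UNIV :: nat set). (\<Sum>p=1..r. i p) \<in> K}"
  define B where "B i = {ws \<in> block_words S (map \<delta> ?L). map list_descents ws = map i ?L}" for i
  have set_L: "set ?L = {1..r}"
    by auto
  have sum_L: "sum_list (map f ?L) = (\<Sum>p=1..r. f p)" for f :: "nat \<Rightarrow> nat"
    using sum.distinct_set_conv_list[of ?L f] unfolding set_L by simp
  have prod_L: "prod_list (map f ?L) = (\<Prod>p=1..r. f p)" for f :: "nat \<Rightarrow> nat"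
    using prod.distinct_set_conv_list[of ?L f] unfolding set_L by simp
  \<comment> \<open>Every entry of an admissible vector is bounded by its sum, hence by a bound of \<open>K\<close>.\<close>
  obtain b where b: "K \<subseteq> {..b}"
    using assms(3) unfolding finite_nat_set_iff_bounded_le by blast
  have "\<I> \<subseteq> {1..r} \<rightarrow>\<^sub>E {..b}"
  proof
    fix i assume i: "i \<in> \<I>"
    have "i p \<le> b" if "p \<in> {1..r}" for p
      using member_le_sum[of p "{1..r}" i] that i b by (force simp: \<I>_def)
    then show "i \<in> {1..r} \<rightarrow>\<^sub>E {..b}"
      using i by (auto simp: \<I>_def PiE_iff)
  qed
  then have fin: "finite \<I>"
    by (rule finite_subset) (simp add: finite_PiE)
  have finB: "finite (B i)" for i
    using finite_block_words[OF assms(1)] by (simp add: B_def)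
  have "{ws \<in> block_words S (map \<delta> ?L). sum_list (map list_descents ws) \<in> K} = (\<Union>i\<in>\<I>. B i)"
  proof (intro equalityI subsetI)
    fix ws assume ws: "ws \<in> {ws \<in> block_words S (map \<delta> ?L). sum_list (map list_descents ws) \<in> K}"
    define i where "i = restrict (\<lambda>p. list_descents (ws ! (p - 1))) {1..r}"
    have "map length ws = map \<delta> ?L"
      using ws by (simp add: block_words_def)
    then have "length ws = r"
      by (metis length_map length_upt diff_Suc_1)
    then have eq: "map list_descents ws = map i ?L"
      by (intro nth_equalityI) (auto simp: i_def simp del: upt_Suc)
    then have "(\<Sum>p=1..r. i p) \<in> K"
      using ws sum_L[of i] by simp
    then have "i \<in> \<I>"
      by (auto simp: \<I>_def i_def)
    then show "ws \<in> (\<Union>i\<in>\<I>. B i)"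
      using ws eq by (auto simp: B_def)
  next
    fix ws assume "ws \<in> (\<Union>i\<in>\<I>. B i)"
    then show "ws \<in> {ws \<in> block_words S (map \<delta> ?L). sum_list (map list_descents ws) \<in> K}"
      using sum_L by (auto simp: B_def \<I>_def simp del: upt_Suc)
  qed
  also have "card (\<Union>i\<in>\<I>. B i) = (\<Sum>i\<in>\<I>. card (B i))"
  proof (rule card_UN_disjoint[OF fin])
    show "\<forall>i\<in>\<I>. \<forall>j\<in>\<I>. i \<noteq> j \<longrightarrow> B i \<inter> B j = {}"
    proof (intro ballI impI)
      fix i j assume ij: "i \<in> \<I>" "j \<in> \<I>" "i \<noteq> j"
      have "map i ?L \<noteq> map j ?L"
      proof
        assume "map i ?L = map j ?L"
        then have "\<forall>p\<in>{1..r}. i p = j p"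
          unfolding map_eq_conv set_L .
        then show False
          using ij PiE_ext[of i "{1..r}" "\<lambda>_. UNIV" j] by (auto simp: \<I>_def)
      qed
      then show "B i \<inter> B j = {}"
        by (auto simp: B_def)
    qed
  qed (use finB in simp)
  finally have card: "card {ws \<in> block_words S (map \<delta> ?L). sum_list (map list_descents ws) \<in> K} =
      (\<Sum>i\<in>\<I>. card (B i))" .
  have "real (card (B i)) = fact (card S) / (\<Prod>p=1..r. fact (\<delta> p)) * real (\<Prod>j=1..r. eulerian (\<delta> j) (i j))" for i
  proof -
    have "card (B i) * prod_list (map fact (map \<delta> ?L)) =
        fact (card S) * prod_list (map2 eulerian (map \<delta> ?L) (map i ?L))"
      unfolding B_def using assms(1,2) sum_L[of \<delta>] by (intro card_block_words_descents) simp_all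
    then have "card (B i) * (\<Prod>p=1..r. fact (\<delta> p)) = fact (card S) * (\<Prod>j=1..r. eulerian (\<delta> j) (i j))"
      unfolding map_map map2_map_map prod_L o_def .
    from arg_cong[OF this, of real]
    have "real (card (B i)) * (\<Prod>p=1..r. fact (\<delta> p)) =
        fact (card S) * real (\<Prod>j=1..r. eulerian (\<delta> j) (i j))"
      by simp
    then show ?thesis
      by (simp add: field_simps)
  qed
  then show ?thesis
    unfolding card \<I>_def[symmetric] by (simp add: sum_distrib_left)
qed

section \<open>Cutting a filling into its blocks\<close>

text \<open>
  Since the block lengths are fixed, a sequence of words is determined by its concatenation, and
  that concatenation is the list of values of a unique filling along \<open>concat us\<close>.
\<close>
lemma fillings_block_words:
  assumes "distinct (concat us)"
  shows "bij_betw (\<lambda>g. map (map g) us) (fillings (concat us))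
    (block_words {1..length (concat us)} (map length us))"
  unfolding bij_betw_def
proof (intro conjI equalityI subsetI inj_onI)
  let ?u = "concat us"
  fix g h assume "g \<in> fillings ?u" "h \<in> fillings ?u" "map (map g) us = map (map h) us"
  moreover from this(3) have "map g ?u = map h ?u"
    by (simp only: map_concat)
  ultimately show "g = h"
    by (auto simp: fillings_def intro!: extensionalityI[of g "set ?u" h])
next
  fix ws assume "ws \<in> (\<lambda>g. map (map g) us) ` fillings (concat us)"
  then obtain g where g: "bij_betw g (set (concat us)) {1..length (concat us)}" and ws: "ws = map (map g) us"
    by (auto simp: fillings_def)
  have "concat ws = map g (concat us)"
    by (simp add: ws map_concat)
  then show "ws \<in> block_words {1..length (concat us)} (map length us)"
    using g assms unfolding block_words_def
    by (simp add: ws bij_betw_def distinct_map del: set_concat)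
next
  let ?u = "concat us"
  fix ws assume "ws \<in> block_words {1..length ?u} (map length us)"
  then have len: "map length ws = map length us" and dist: "distinct (concat ws)"
    and set: "set (concat ws) = {1..length ?u}"
    by (simp_all add: block_words_def)
  have len': "length (concat ws) = length ?u"
    by (simp add: length_concat len)
  define g where "g = restrict (\<lambda>x. the (map_of (zip ?u (concat ws)) x)) (set ?u)"
  have "g (?u ! t) = concat ws ! t" if "t < length ?u" for t
    using that assms len' by (simp add: g_def map_of_zip_nth del: set_concat)
  then have map_g: "map g ?u = concat ws"
    using len' by (intro nth_equalityI) simp_all
  then have "bij_betw g (set ?u) {1..length ?u}"
    using dist set unfolding bij_betw_def by (metis distinct_map list.set_map)
  then have "g \<in> fillings ?u"
    by (simp add: fillings_def g_def)
  moreover have "ws = map (map g) us"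
  proof (rule concat_injective)
    show "concat ws = concat (map (map g) us)"
      using map_g by (simp only: map_concat)
    show "length ws = length (map (map g) us)"
      using len by (metis length_map)
    show "\<forall>(x, y)\<in>set (zip ws (map (map g) us)). length x = length y"
      using len by (auto simp: set_zip) (metis length_map nth_map)
  qed
  ultimately show "ws \<in> (\<lambda>g. map (map g) us) ` fillings ?u"
    by blast
qed

section \<open>The blocks between unavailable spots\<close>

text \<open>
  The maximal runs of spots strictly between \<open>S 0 < S 1 < \<dots> < S r\<close>, including empty ones.
\<close>
definition gap_blocks :: "(nat \<Rightarrow> nat) \<Rightarrow> nat \<Rightarrow> nat list list" where
  "gap_blocks S r = map (\<lambda>p. [Suc (S (p - 1))..<S p]) [1..<Suc r]"

lemma gap_blocks_0 [simp]: "gap_blocks S 0 = []"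
  by (simp add: gap_blocks_def)

lemma gap_blocks_Suc [simp]: "gap_blocks S (Suc r) = gap_blocks S r @ [[Suc (S r)..<S (Suc r)]]"
  by (simp add: gap_blocks_def)

lemma gap_blocks_set:
  assumes "S 0 = 0" and "strict_mono_on {..r} S"
  shows "set (concat (gap_blocks S r)) = {..<S r} - S ` {..r}"
  using assms
proof (induction r)
  case (Suc r)
  have "strict_mono_on {..r} S"
    using Suc.prems(2) by (auto simp: strict_mono_on_def)
  then have IH: "set (concat (gap_blocks S r)) = {..<S r} - S ` {..r}"
    using Suc by simp
  define T where "T = S ` {..r}"
  have "S r < S (Suc r)" and "T \<subseteq> {..S r}" and "S r \<in> T"
    using strict_mono_onD[OF Suc.prems(2)] by (auto simp: le_less T_def)
  then have "({..<S r} - T) \<union> {Suc (S r)..<S (Suc r)} = {..<S (Suc r)} - insert (S (Suc r)) T"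
    by (auto simp: Suc_le_eq) (metis linorder_neqE_nat)
  then show ?case
    unfolding gap_blocks_Suc concat_append set_append IH
    by (simp add: atMost_Suc T_def)
qed simp

lemma gap_blocks_sorted:
  assumes "S 0 = 0" and "strict_mono_on {..r} S"
  shows "sorted_wrt (<) (concat (gap_blocks S r))"
  using assms
proof (induction r)
  case (Suc r)
  have mono: "strict_mono_on {..r} S"
    using Suc.prems(2) by (auto simp: strict_mono_on_def)
  then show ?case
    using Suc gap_blocks_set[of S r] by (auto simp: sorted_wrt_append simp del: set_concat)
qed simp

lemma list_descents_interval:
  "list_descents (map g [a..<b]) = card {x. a < x \<and> x < b \<and> g x < g (x - 1)}"
proof -
  have "bij_betw (\<lambda>j. Suc (a + j))
      {j. Suc j < length (map g [a..<b]) \<and> map g [a..<b] ! Suc j < map g [a..<b] ! j}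
      {x. a < x \<and> x < b \<and> g x < g (x - 1)}"
    by (rule bij_betwI[where g = "\<lambda>x. x - Suc a"]) auto
  then show ?thesis
    unfolding list_descents_def by (rule bij_betw_same_card)
qed

text \<open>
  Two adjacent spots that both avoid the values of \<open>S\<close> lie in the same gap, so the descents of \<open>g\<close>
  across adjacent spots are the descents of the individual words. In the induction, the last gap
  is separated from the earlier ones by the spot \<open>S r\<close>.
\<close>
lemma card_gap_descents:
  assumes "S 0 = 0" and "strict_mono_on {..r} S"
  shows "card {x \<in> set (concat (gap_blocks S r)). x - 1 \<in> set (concat (gap_blocks S r)) \<and> g x < g (x - 1)} =
    sum_list (map list_descents (map (map g) (gap_blocks S r)))"
  using assms
proof (induction r)
  case (Suc r)
  define V where "V = set (concat (gap_blocks S r))"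
  define D where "D = {x. Suc (S r) < x \<and> x < S (Suc r) \<and> g x < g (x - 1)}"
  have mono: "strict_mono_on {..r} S"
    using Suc.prems(2) by (auto simp: strict_mono_on_def)
  have V: "x < S r" if "x \<in> V" for x
    using that unfolding V_def gap_blocks_set[OF Suc.prems(1) mono] by simp
  have "set (concat (gap_blocks S (Suc r))) = V \<union> {Suc (S r)..<S (Suc r)}"
    by (simp add: V_def)
  then have "{x \<in> set (concat (gap_blocks S (Suc r))).
      x - 1 \<in> set (concat (gap_blocks S (Suc r))) \<and> g x < g (x - 1)} =
      {x \<in> V. x - 1 \<in> V \<and> g x < g (x - 1)} \<union> D"
    using V by (force simp: D_def)
  moreover have "card ({x \<in> V. x - 1 \<in> V \<and> g x < g (x - 1)} \<union> D) =
      card {x \<in> V. x - 1 \<in> V \<and> g x < g (x - 1)} + card D"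
  proof (rule card_Un_disjoint)
    show "finite D"
      by (rule finite_subset[of _ "{..<S (Suc r)}"]) (auto simp: D_def)
    show "{x \<in> V. x - 1 \<in> V \<and> g x < g (x - 1)} \<inter> D = {}"
      using V by (force simp: D_def)
  qed (simp add: V_def)
  moreover have "card D = list_descents (map g [Suc (S r)..<S (Suc r)])"
    by (simp add: list_descents_interval D_def)
  ultimately show ?case
    using Suc.IH[OF Suc.prems(1) mono] unfolding V_def[symmetric] by simp
qed simp

lemma card_forced_lucky:
  assumes "0 \<notin> set u"
  shows "card (forced_lucky u g) =
    of_bool (1 \<in> set u) + card {x \<in> set u. x - 1 \<in> set u \<and> g x < g (x - 1)}"
proof -
  have "forced_lucky u g = ({1} \<inter> set u) \<union> {x \<in> set u. x - 1 \<in> set u \<and> g x < g (x - 1)}"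
    by (auto simp: forced_lucky_def)
  also have "card \<dots> = card ({1} \<inter> set u) + card {x \<in> set u. x - 1 \<in> set u \<and> g x < g (x - 1)}"
    using assms by (intro card_Un_disjoint) auto
  also have "card ({1} \<inter> set u) = of_bool (1 \<in> set u)"
    by simp
  finally show ?thesis .
qed

theorem theorem3p10:
  fixes n m k :: nat and s \<delta> :: "nat \<Rightarrow> nat" and u :: "nat list"
  assumes "n \<ge> 1" and "m \<ge> 1" and "k \<le> n"
    and "strict_mono_on {1..m} s" and "s ` {1..m} \<subseteq> {1..n+m}"
    and "sorted_wrt (<) u" and "set u = {1..n+m} - s ` {1..m}"
    and "\<delta> 1 = s 1 - 1"
    and "\<forall>p\<in>{2..m}. \<delta> p = s p - s (p - 1) - 1"
    and "\<delta> (m + 1) = n + m - s m"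
  shows "real (card (\<Union>I\<in>{I. I \<subseteq> {1..n} \<and> card I = k}. outcomes_with_lucky u I)) =
    fact n / (\<Prod>p=1..m+1. fact (\<delta> p)) *
    real (\<Sum>i\<in>{i \<in> {1..m+1} \<rightarrow>\<^sub>E (UNIV :: nat set).
                 int (\<Sum>p=1..m+1. i p) \<le> max (int k - int (\<delta> 1)) (int k - 1)}.
            \<Prod>j=1..m+1. eulerian (\<delta> j) (i j))"
proof -
  \<comment> \<open>Sentinels at \<open>0\<close> and \<open>n + m + 1\<close> make the first and the last block gaps like the others.\<close>
  define S where "S p = (if p = 0 then 0 else if p \<le> m then s p else n + m + 1)" for p
  define us where "us = gap_blocks S (m + 1)"
  have S0: "S 0 = 0"
    by (simp add: S_def)
  have s_range: "1 \<le> s p" "s p \<le> n + m" if "1 \<le> p" "p \<le> m" for p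
    using subsetD[OF assms(5) imageI[of p "{1..m}" s]] that by simp_all
  have mono: "strict_mono_on {..m + 1} S"
  proof (rule strict_mono_onI)
    fix p q assume "p \<in> {..m + 1}" "q \<in> {..m + 1}" "p < q"
    then show "S p < S q"
      using s_range[of p] s_range[of q] strict_mono_onD[OF assms(4), of p q] by (auto simp: S_def)
  qed
  have S_img: "S ` {..m + 1} = insert 0 (insert (n + m + 1) (s ` {1..m}))"
  proof -
    have "{..m + 1} = insert 0 (insert (m + 1) {1..m})"
      by auto
    moreover have "S ` {1..m} = s ` {1..m}"
      by (auto simp: S_def)
    moreover have "S 0 = 0" "S (m + 1) = n + m + 1"
      by (simp_all add: S_def)
    ultimately show ?thesis
      by (metis image_insert)
  qed
  have set_u: "set (concat us) = set u"
    unfolding us_def gap_blocks_set[OF S0 mono] S_img assms(7)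
    by (auto simp: S_def)
  have u: "concat us = u"
    using gap_blocks_sorted[OF S0 mono] assms(6) set_u
    by (intro strict_sorted_equal) (simp_all add: us_def del: set_concat)
  have dist: "distinct u" and pos: "0 \<notin> set u"
    using assms(6,7) strict_sorted_iff by auto
  have "card (s ` {1..m}) = m"
    using strict_mono_on_imp_inj_on[OF assms(4)] by (simp add: card_image)
  then have len_u: "length u = n"
    using assms(5,7) distinct_card[OF dist] by (simp add: card_Diff_subset)
  have "\<delta> p = S p - S (p - 1) - 1" if "p \<in> {1..m + 1}" for p
  proof -
    have "p = 1 \<or> p \<in> {2..m} \<or> p = m + 1"
      using that by auto
    then show ?thesis
      using assms(2,8,9,10) by (auto simp: S_def)
  qed
  then have lens: "map length us = map \<delta> [1..<Suc (m + 1)]"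
    by (auto simp: us_def gap_blocks_def simp del: upt_Suc)
  have "n = sum_list (map length us)"
    using len_u u by (metis length_concat)
  also have "\<dots> = (\<Sum>p=1..m+1. \<delta> p)"
    unfolding lens sum_set_upt_conv_sum_list_nat[symmetric] by (simp add: atLeastLessThanSuc_atLeastAtMost del: upt_Suc)
  finally have n_sum: "n = (\<Sum>p=1..m+1. \<delta> p)" .
  \<comment> \<open>\<open>e\<close> counts the car forced to be lucky by standing in spot 1.\<close>
  define e :: nat where "e = of_bool (\<delta> 1 > 0)"
  have e: "of_bool (1 \<in> set u) = e"
  proof -
    have "1 \<in> set u \<longleftrightarrow> \<delta> 1 > 0"
    proof -
      have "s p \<noteq> 1" if "p \<in> {1..m}" "p \<noteq> 1" for p
        using strict_mono_onD[OF assms(4), of 1 p] s_range[of 1] assms(2) that by auto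
      then have "1 \<in> s ` {1..m} \<longleftrightarrow> s 1 = 1"
        using assms(2) by (metis atLeastAtMost_iff image_iff le_refl)
      then show ?thesis
        using assms(1,2,7,8) s_range[of 1] by auto
    qed
    then show ?thesis
      by (simp add: e_def)
  qed
  have forced: "card (forced_lucky u g) = e + sum_list (map list_descents (map (map g) us))" for g
    using card_forced_lucky[OF pos, of g] card_gap_descents[OF S0 mono, of g]
    unfolding us_def[symmetric] u e by simp
  define K where "K = {d. e + d \<le> k}"
  have "K \<subseteq> {..k}"
    by (auto simp: K_def)
  then have "finite K"
    using finite_subset by blast
  have K: "d \<in> K \<longleftrightarrow> int d \<le> max (int k - int (\<delta> 1)) (int k - 1)" for d
    by (auto simp: K_def e_def)
  have "bij_betw (\<lambda>g. map (map g) us) {g \<in> fillings u. card (forced_lucky u g) \<le> k}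
     {ws \<in> block_words {1..n} (map \<delta> [1..<Suc (m + 1)]). sum_list (map list_descents ws) \<in> K}"
  proof -
    have bij: "bij_betw (\<lambda>g. map (map g) us) (fillings u) (block_words {1..n} (map \<delta> [1..<Suc (m + 1)]))"
      using fillings_block_words[of us] dist unfolding u len_u lens by simp
    then show ?thesis
      unfolding forced K_def
      by (auto simp: bij_betw_def inj_on_def image_iff simp del: upt_Suc map_map)
  qed
  then have "card {g \<in> fillings u. card (forced_lucky u g) \<le> k} =
     card {ws \<in> block_words {1..n} (map \<delta> [1..<Suc (m + 1)]). sum_list (map list_descents ws) \<in> K}"
    by (rule bij_betw_same_card)
  moreover have "card (\<Union>I\<in>{I. I \<subseteq> {1..n} \<and> card I = k}. outcomes_with_lucky u I) =
     card {g \<in> fillings u. card (forced_lucky u g) \<le> k}"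
    using outcomes_with_lucky_card[OF dist pos, of k] assms(3)
      card_image[OF inj_on_subset[OF inj_on_filled_street[OF pos]]]
    by (simp add: len_u)
  ultimately show ?thesis
    using card_block_words_total_descents[OF _ _ \<open>finite K\<close>, where S = "{1..n}" and r = "m + 1" and \<delta> = \<delta>] n_sum
    unfolding K by simp
qed

end
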